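(* Let $\mathbb{F}$ be a finite field and let $u(X)\in\mathbb{F}[X]$ be a nonconstant polynomial. Then for all $f,g\in\mathbb{F}[X]$, $$\deg_u(fg)\ \le\ \deg_u(f)+\deg_u(g).$$
   Context: For a nonconstant $u\in\mathbb{F}[X]$, every $f\in\mathbb{F}[X]$ has a unique expansion $f(X)=\sum_i c_i(X)u(X)^i$ with $\deg(c_i)<\deg(u)$ for all $i$. The $u$-base degree of $f$ is $\deg_u(f):=\max_i\deg(c_i)$, with the convention $\deg(0)=-\infty$ (so $\deg_u(0)=-\infty$, and $-\infty$ plus anything is $-\infty$). *)

theory Defs
  imports "HOL-Computational_Algebra.Polynomial" "HOL-Library.Extended_Real"
begin

text \<open>The library's \<^const>\<open>degree\<close> sends the zero polynomial to \<open>0\<close>; here \<open>deg(0) = -\<infinity>\<close> is needed.\<close>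

definition pdeg :: "'a::zero poly \<Rightarrow> ereal" where
  "pdeg p = (if p = 0 then -\<infinity> else ereal (real (degree p)))"

text \<open>
  A finite coefficient sequence \<open>(c\<^sub>i)\<close> in \<open>\<F>[X]\<close> is encoded as a polynomial over \<open>\<F>[X]\<close> with
  \<open>i\<close>-th coefficient \<open>c\<^sub>i\<close>, so that \<open>poly c u\<close> is the sum of the \<open>c\<^sub>i u\<^sup>i\<close>.
\<close>

definition is_base_expansion :: "'a::field poly \<Rightarrow> 'a poly \<Rightarrow> 'a poly poly \<Rightarrow> bool" where
  "is_base_expansion u f c \<longleftrightarrow> f = poly c u \<and> (\<forall>i. pdeg (coeff c i) < pdeg u)"

lemma pdeg_less_iff: "0 < degree u \<Longrightarrow> pdeg p < pdeg u \<longleftrightarrow> degree p < degree u"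
  by (auto simp: pdeg_def)

lemma is_base_expansion_pCons:
  assumes "0 < degree u"
  shows "is_base_expansion u f (pCons a c) \<longleftrightarrow>
    f mod u = a \<and> is_base_expansion u (f div u) c"
proof
  assume L: "is_base_expansion u f (pCons a c)"
  have 1: "f = a + u * poly c u" using L by (simp add: is_base_expansion_def)
  have c: "pdeg (coeff (pCons a c) i) < pdeg u" for i
    using L by (simp add: is_base_expansion_def)
  have "degree a < degree u" using c[of 0] assms by (simp add: pdeg_less_iff)
  then have "a mod u = a" "a div u = 0" by (simp_all add: mod_poly_less div_poly_less)
  moreover have "u \<noteq> 0" using assms by auto
  ultimately have "f mod u = a" "f div u = poly c u" using 1 by simp_all
  then show "f mod u = a \<and> is_base_expansion u (f div u) c"
    using c[of "Suc i" for i] by (simp add: is_base_expansion_def)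
next
  assume R: "f mod u = a \<and> is_base_expansion u (f div u) c"
  then have "f = poly (pCons a c) u"
    using div_mult_mod_eq[of f u] by (simp add: is_base_expansion_def algebra_simps)
  moreover have "degree a < degree u" 
    using R assms by (metis degree_0 degree_mod_less less_numeral_extra(3))
  ultimately show "is_base_expansion u f (pCons a c)"
    using R assms by (auto simp: is_base_expansion_def pdeg_less_iff coeff_pCons split: nat.split)
qed

lemma base_expansion_ex1:
  assumes "0 < degree u"
  shows "\<exists>!c. is_base_expansion u f c"
proof (rule ex_ex1I)
  show "\<exists>c. is_base_expansion u f c"
  proof (induction "degree f" arbitrary: f rule: less_induct)
    case less
    show ?case
    proof (cases "degree f < degree u")
      case True
      then have "is_base_expansion u f [:f:]"
        using assms by (auto simp: is_base_expansion_def pdeg_less_iff coeff_pCons split: nat.split)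
      then show ?thesis ..
    next
      case False
      then have "degree (f div u) < degree f" 
        using assms by (simp add: degree_div_less)
      then obtain c where "is_base_expansion u (f div u) c" using less by blast
      then show ?thesis using is_base_expansion_pCons[OF assms] by blast
    qed
  qed
next
  fix c d
  assume "is_base_expansion u f c" "is_base_expansion u f d"
  then show "c = d"
  proof (induction c d arbitrary: f rule: poly_induct2)
    case (pCons a p b q)
    then show ?case using is_base_expansion_pCons[OF assms] by metis
  qed simp
qed

definition base_expansion :: "'a::field poly \<Rightarrow> 'a poly \<Rightarrow> 'a poly poly" where
  "base_expansion u f = (THE c. is_base_expansion u f c)"

definition base_deg :: "'a::field poly \<Rightarrow> 'a poly \<Rightarrow> ereal" where
  "base_deg u f =
    (MAX i\<in>{..degree (base_expansion u f)}. pdeg (coeff (base_expansion u f) i))"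

end

theory Submission
  imports Defs
begin

text \<open>
  The product of the expansions of \<open>f\<close> and \<open>g\<close>, multiplied out as polynomials in \<open>u\<close>, has
  coefficients of degree at most \<open>m = deg\<^sub>u(f) + deg\<^sub>u(g)\<close>. If \<open>m < deg u\<close>, no carries occur and
  this product is the expansion of \<open>fg\<close>; otherwise the bound is trivial, since \<open>deg\<^sub>u < deg u\<close>.
\<close>

lemma pdeg_0 [simp]: "pdeg 0 = -\<infinity>"
  by (simp add: pdeg_def)

lemma pdeg_mult:
  fixes p q :: "'a::{comm_semiring_0, semiring_no_zero_divisors} poly"
  shows "pdeg (p * q) = pdeg p + pdeg q"
  by (simp add: pdeg_def degree_mult_eq)

lemma pdeg_add_le:
  assumes "pdeg p \<le> x" "pdeg q \<le> x"
  shows "pdeg (p + q) \<le> x"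
proof (cases "p = 0 \<or> q = 0 \<or> p + q = 0")
  case False
  then have "pdeg (p + q) \<le> max (pdeg p) (pdeg q)"
    using degree_add_le_max[of p q] by (auto simp: pdeg_def max_def split: if_splits)
  then show ?thesis
    using assms by (meson max.boundedI order_trans)
qed (use assms in auto)

lemma pdeg_sum_le:
  assumes "\<And>i. i \<in> A \<Longrightarrow> pdeg (f i) \<le> x"
  shows "pdeg (\<Sum>i\<in>A. f i) \<le> x"
  using assms by (induction A rule: infinite_finite_induct) (auto intro: pdeg_add_le)

text \<open>Each coefficient of \<open>p * q\<close> is a convolution sum; its terms have degree at
  most \<open>x + y\<close>, and adding polynomials preserves such a bound.\<close>

lemma pdeg_coeff_mult_le:
  fixes p q :: "'a::{comm_semiring_0, semiring_no_zero_divisors} poly poly"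
  assumes "\<And>i. pdeg (coeff p i) \<le> x" "\<And>i. pdeg (coeff q i) \<le> y"
  shows "pdeg (coeff (p * q) n) \<le> x + y"
  unfolding coeff_mult by (intro pdeg_sum_le) (simp add: pdeg_mult add_mono assms)

text \<open>Beyond the range of the maximum the coefficients vanish, and their \<open>pdeg\<close>
  -\<infinity> lies below every \<open>x\<close>.\<close>

lemma base_deg_le_iff:
  "base_deg u f \<le> x \<longleftrightarrow> (\<forall>i. pdeg (coeff (base_expansion u f) i) \<le> x)"
proof -
  have "pdeg (coeff (base_expansion u f) i) \<le> x" if "degree (base_expansion u f) < i" for i
    using that by (simp add: coeff_eq_0)
  then show ?thesis
    by (auto simp: base_deg_def) (metis atMost_iff not_le)
qed

lemma is_base_expansion_base_expansion:
  "0 < degree u \<Longrightarrow> is_base_expansion u f (base_expansion u f)"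
  unfolding base_expansion_def by (rule theI') (rule base_expansion_ex1)

lemma base_expansion_eqI:
  "0 < degree u \<Longrightarrow> is_base_expansion u f c \<Longrightarrow> base_expansion u f = c"
  using base_expansion_ex1 is_base_expansion_base_expansion by blast

theorem lemma2p2:
  fixes u f g :: "'a::{field, finite} poly"
  assumes "degree u > 0"
  shows "base_deg u (f * g) \<le> base_deg u f + base_deg u g"
proof -
  let ?c = "base_expansion u f" and ?d = "base_expansion u g"
  let ?m = "base_deg u f + base_deg u g"
  have expansion: "is_base_expansion u h (base_expansion u h)" for h
    using assms by (rule is_base_expansion_base_expansion)
  \<comment> \<open>The two coefficient bounds come from \<open>base_deg_le_iff\<close> with
    \<open>x\<close> the base degree itself.\<close>
  have coeff_le: "pdeg (coeff (?c * ?d) n) \<le> ?m" for n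
    by (rule pdeg_coeff_mult_le) (use base_deg_le_iff in blast)+
  show ?thesis
  proof (cases "?m < pdeg u")
    case True
    then have "pdeg (coeff (?c * ?d) n) < pdeg u" for n
      using coeff_le order_le_less_trans by blast
    \<comment> \<open>Evaluation at \<open>u\<close> is multiplicative, so \<open>?c * ?d\<close>
      evaluates to \<open>f * g\<close>; uniqueness then identifies it as the expansion.\<close>
    then have "is_base_expansion u (f * g) (?c * ?d)"
      using expansion[of f] expansion[of g] by (simp add: is_base_expansion_def)
    then have "base_expansion u (f * g) = ?c * ?d"
      using assms by (simp add: base_expansion_eqI)
    then show ?thesis
      using coeff_le by (simp add: base_deg_le_iff)
  next
    case False
    have "base_deg u (f * g) \<le> pdeg u"
      using expansion[of "f * g"] by (simp add: base_deg_le_iff is_base_expansion_def less_imp_le)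
    then show ?thesis
      using False by simp
  qed
qed

end
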